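(* Let $R$ and $S$ be local rings and let $V$ be an $(R,S)$-bimodule. Then the following are equivalent: (1) The formal triangular matrix ring $\begin{pmatrix} R&V\\ 0&S\end{pmatrix}$ is perfectly clean. (2) For any $a\in J(R)$, $b\in 1+J(S)$, $v\in V$, there exists a unique $x\in V$ such that $ax-xb=v$.
   Context: Rings are associative with identity, not necessarily commutative. $U(T)$ is the group of invertible elements of a ring $T$ and $J(T)$ its Jacobson radical. For $a\in T$, $comm(a)=\{x\in T\mid xa=ax\}$ and $comm^2(a)=\{x\in T\mid xy=yx \text{ for all } y\in comm(a)\}$. A ring $T$ is perfectly clean if for every $a\in T$ there is an idempotent $e\in comm^2(a)$ with $a-e\in U(T)$. A ring is local if it has only one maximal right ideal. *)

theory Defs
  imports "HOL-Algebra.Ideal" "HOL-Algebra.Module"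
begin

text \<open>The locale \<^verbatim>\<open>maximalideal\<close> of HOL-Algebra is about two-sided ideals, so one-sided
  ideals are introduced here in the same style.\<close>

locale right_ideal = additive_subgroup I R + ring R for I and R (structure) +
  assumes I_r_closed: "\<lbrakk>a \<in> I; x \<in> carrier R\<rbrakk> \<Longrightarrow> a \<otimes> x \<in> I"

locale maximal_right_ideal = right_ideal +
  assumes I_notcarr: "carrier R \<noteq> I"
    and I_maximal: "\<lbrakk>right_ideal J R; I \<subseteq> J; J \<subseteq> carrier R\<rbrakk> \<Longrightarrow> J = I \<or> J = carrier R"

definition jacobson_radical :: "('a, 'm) ring_scheme \<Rightarrow> 'a set"
  where "jacobson_radical R = {x \<in> carrier R. \<forall>M. maximal_right_ideal M R \<longrightarrow> x \<in> M}"

locale local_ring = ring +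
  assumes unique_maximal_right_ideal: "\<exists>!M. maximal_right_ideal M R"

definition comm :: "('a, 'm) ring_scheme \<Rightarrow> 'a \<Rightarrow> 'a set"
  where "comm T a = {x \<in> carrier T. x \<otimes>\<^bsub>T\<^esub> a = a \<otimes>\<^bsub>T\<^esub> x}"

definition comm2 :: "('a, 'm) ring_scheme \<Rightarrow> 'a \<Rightarrow> 'a set"
  where "comm2 T a = {x \<in> carrier T. \<forall>y\<in>comm T a. x \<otimes>\<^bsub>T\<^esub> y = y \<otimes>\<^bsub>T\<^esub> x}"

locale perfectly_clean_ring = ring T for T (structure) +
  assumes perfectly_clean:
    "a \<in> carrier T \<Longrightarrow> \<exists>e\<in>comm2 T a. e \<otimes> e = e \<and> a \<ominus> e \<in> Units T"

text \<open>As in HOL-Algebra's \<^verbatim>\<open>module\<close> record, the multiplicative fields inherited from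
  \<^verbatim>\<open>ring\<close> carry no meaning for a bimodule. HOL-Algebra's \<^verbatim>\<open>module\<close> locale assumes a
  commutative ring of scalars and hence cannot be reused; only its record is.\<close>

record ('r, 's, 'v) bimodule = "('r, 'v) module" +
  rsmult :: "['v, 's] \<Rightarrow> 'v" (infixl \<open>\<triangleleft>\<index>\<close> 70)

locale bimodule = R?: ring R + S?: ring S + V?: abelian_group V
  for R (structure) and S (structure) and V (structure) +
  assumes lsmult_closed:
      "\<lbrakk>r \<in> carrier R; x \<in> carrier V\<rbrakk> \<Longrightarrow> r \<odot>\<^bsub>V\<^esub> x \<in> carrier V"
    and lsmult_distr_scalar:
      "\<lbrakk>r \<in> carrier R; r' \<in> carrier R; x \<in> carrier V\<rbrakk> \<Longrightarrow>
        (r \<oplus>\<^bsub>R\<^esub> r') \<odot>\<^bsub>V\<^esub> x = r \<odot>\<^bsub>V\<^esub> x \<oplus>\<^bsub>V\<^esub> r' \<odot>\<^bsub>V\<^esub> x"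
    and lsmult_distr_vector:
      "\<lbrakk>r \<in> carrier R; x \<in> carrier V; y \<in> carrier V\<rbrakk> \<Longrightarrow>
        r \<odot>\<^bsub>V\<^esub> (x \<oplus>\<^bsub>V\<^esub> y) = r \<odot>\<^bsub>V\<^esub> x \<oplus>\<^bsub>V\<^esub> r \<odot>\<^bsub>V\<^esub> y"
    and lsmult_assoc:
      "\<lbrakk>r \<in> carrier R; r' \<in> carrier R; x \<in> carrier V\<rbrakk> \<Longrightarrow>
        (r \<otimes>\<^bsub>R\<^esub> r') \<odot>\<^bsub>V\<^esub> x = r \<odot>\<^bsub>V\<^esub> (r' \<odot>\<^bsub>V\<^esub> x)"
    and lsmult_one: "x \<in> carrier V \<Longrightarrow> \<one>\<^bsub>R\<^esub> \<odot>\<^bsub>V\<^esub> x = x"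
    and rsmult_closed:
      "\<lbrakk>s \<in> carrier S; x \<in> carrier V\<rbrakk> \<Longrightarrow> x \<triangleleft>\<^bsub>V\<^esub> s \<in> carrier V"
    and rsmult_distr_scalar:
      "\<lbrakk>s \<in> carrier S; s' \<in> carrier S; x \<in> carrier V\<rbrakk> \<Longrightarrow>
        x \<triangleleft>\<^bsub>V\<^esub> (s \<oplus>\<^bsub>S\<^esub> s') = x \<triangleleft>\<^bsub>V\<^esub> s \<oplus>\<^bsub>V\<^esub> x \<triangleleft>\<^bsub>V\<^esub> s'"
    and rsmult_distr_vector:
      "\<lbrakk>s \<in> carrier S; x \<in> carrier V; y \<in> carrier V\<rbrakk> \<Longrightarrow>
        (x \<oplus>\<^bsub>V\<^esub> y) \<triangleleft>\<^bsub>V\<^esub> s = x \<triangleleft>\<^bsub>V\<^esub> s \<oplus>\<^bsub>V\<^esub> y \<triangleleft>\<^bsub>V\<^esub> s"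
    and rsmult_assoc:
      "\<lbrakk>s \<in> carrier S; s' \<in> carrier S; x \<in> carrier V\<rbrakk> \<Longrightarrow>
        x \<triangleleft>\<^bsub>V\<^esub> (s \<otimes>\<^bsub>S\<^esub> s') = (x \<triangleleft>\<^bsub>V\<^esub> s) \<triangleleft>\<^bsub>V\<^esub> s'"
    and rsmult_one: "x \<in> carrier V \<Longrightarrow> x \<triangleleft>\<^bsub>V\<^esub> \<one>\<^bsub>S\<^esub> = x"
    and smult_compat:
      "\<lbrakk>r \<in> carrier R; s \<in> carrier S; x \<in> carrier V\<rbrakk> \<Longrightarrow>
        (r \<odot>\<^bsub>V\<^esub> x) \<triangleleft>\<^bsub>V\<^esub> s = r \<odot>\<^bsub>V\<^esub> (x \<triangleleft>\<^bsub>V\<^esub> s)"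

text \<open>The triple \<^verbatim>\<open>(r, v, s)\<close> stands for the matrix with diagonal entries \<^verbatim>\<open>r\<close>, \<^verbatim>\<open>s\<close> and
  upper right entry \<^verbatim>\<open>v\<close>.\<close>

definition triangular_ring ::
  "('r, 'a) ring_scheme \<Rightarrow> ('r, 's, 'v, 'c) bimodule_scheme \<Rightarrow> ('s, 'b) ring_scheme
    \<Rightarrow> ('r \<times> 'v \<times> 's) ring"
  where "triangular_ring R V S =
    \<lparr>carrier = carrier R \<times> carrier V \<times> carrier S,
     mult = (\<lambda>(r, v, s) (r', v', s').
       (r \<otimes>\<^bsub>R\<^esub> r', r \<odot>\<^bsub>V\<^esub> v' \<oplus>\<^bsub>V\<^esub> v \<triangleleft>\<^bsub>V\<^esub> s', s \<otimes>\<^bsub>S\<^esub> s')),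
     one = (\<one>\<^bsub>R\<^esub>, \<zero>\<^bsub>V\<^esub>, \<one>\<^bsub>S\<^esub>),
     zero = (\<zero>\<^bsub>R\<^esub>, \<zero>\<^bsub>V\<^esub>, \<zero>\<^bsub>S\<^esub>),
     add = (\<lambda>(r, v, s) (r', v', s').
       (r \<oplus>\<^bsub>R\<^esub> r', v \<oplus>\<^bsub>V\<^esub> v', s \<oplus>\<^bsub>S\<^esub> s'))\<rparr>"

context bimodule
begin

lemma lsmult_zero: "r \<in> carrier R \<Longrightarrow> r \<odot>\<^bsub>V\<^esub> \<zero>\<^bsub>V\<^esub> = \<zero>\<^bsub>V\<^esub>"
  using lsmult_distr_vector[of r "\<zero>\<^bsub>V\<^esub>" "\<zero>\<^bsub>V\<^esub>"] lsmult_closed[of r "\<zero>\<^bsub>V\<^esub>"]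
  by (simp add: V.add.r_cancel_one')

lemma rsmult_zero: "s \<in> carrier S \<Longrightarrow> \<zero>\<^bsub>V\<^esub> \<triangleleft>\<^bsub>V\<^esub> s = \<zero>\<^bsub>V\<^esub>"
  using rsmult_distr_vector[of s "\<zero>\<^bsub>V\<^esub>" "\<zero>\<^bsub>V\<^esub>"] rsmult_closed[of s "\<zero>\<^bsub>V\<^esub>"]
  by (simp add: V.add.r_cancel_one')

lemma ring_triangular_ring: "ring (triangular_ring R V S)"
proof (rule ringI)
  show "abelian_group (triangular_ring R V S)"
  proof (rule abelian_groupI)
    fix x assume "x \<in> carrier (triangular_ring R V S)"
    then obtain r v s where x: "x = (r, v, s)" "r \<in> carrier R" "v \<in> carrier V" "s \<in> carrier S"
      by (auto simp: triangular_ring_def)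
    show "\<exists>y\<in>carrier (triangular_ring R V S).
        y \<oplus>\<^bsub>triangular_ring R V S\<^esub> x = \<zero>\<^bsub>triangular_ring R V S\<^esub>"
      by (rule bexI[of _ "(\<ominus>\<^bsub>R\<^esub> r, \<ominus>\<^bsub>V\<^esub> v, \<ominus>\<^bsub>S\<^esub> s)"])
        (use x in \<open>auto simp: triangular_ring_def R.l_neg S.l_neg V.l_neg\<close>)
  qed (auto simp: triangular_ring_def R.a_ac S.a_ac V.a_ac)
  show "monoid (triangular_ring R V S)"
    by (rule monoidI)
      (auto simp: triangular_ring_def lsmult_closed rsmult_closed lsmult_one rsmult_one
        lsmult_zero rsmult_zero R.m_assoc S.m_assoc V.a_assoc lsmult_distr_vector
        rsmult_distr_vector lsmult_assoc rsmult_assoc smult_compat)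
qed (auto simp: triangular_ring_def lsmult_closed rsmult_closed lsmult_distr_scalar
    rsmult_distr_scalar lsmult_distr_vector rsmult_distr_vector
    R.l_distr S.l_distr R.r_distr S.r_distr V.a_ac)

end

end

theory Submission
  imports Defs
begin

text \<open>Write \<^verbatim>\<open>D(a,b)\<close> (formally \<^verbatim>\<open>sylvester a b\<close>) for the map sending \<^verbatim>\<open>x\<close> to \<^verbatim>\<open>ax - xb\<close>. Two triangular matrices
  \<^verbatim>\<open>(r, y, s)\<close> and \<^verbatim>\<open>(a, v, b)\<close> commute iff their diagonals commute and \<^verbatim>\<open>D(r,s) v = D(a,b) y\<close>.
  The only elements for which neither \<^verbatim>\<open>0\<close> nor \<^verbatim>\<open>1\<close> is a suitable idempotent have one diagonal
  entry in the radical and the other one in \<^verbatim>\<open>1\<close> plus the radical. If \<^verbatim>\<open>a\<close> is in the radical, the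
  idempotent must be \<^verbatim>\<open>(1, x, 0)\<close>, and it commutes with \<^verbatim>\<open>(a, v, b)\<close> iff \<^verbatim>\<open>D(a,b) x = v\<close>. It lies in
  the double commutant when \<^verbatim>\<open>D(a,b)\<close> is injective, because \<^verbatim>\<open>D(a,b)\<close> commutes with \<^verbatim>\<open>D(r,s)\<close>;
  conversely, \<^verbatim>\<open>(0, w, 0)\<close> commutes with \<^verbatim>\<open>(a, 0, b)\<close> for \<^verbatim>\<open>w\<close> in the kernel of \<^verbatim>\<open>D(a,b)\<close>, but commutes
  with \<^verbatim>\<open>(1, x, 0)\<close> only if \<^verbatim>\<open>w = 0\<close>. The remaining case reduces to this one since
  \<^verbatim>\<open>D(1-a,1-b) = -D(a,b)\<close>.\<close>

text \<open>Meant for sums rearranged by \<open>a_ac\<close>, where an element and its negative may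
  end up separated by a third summand.\<close>

lemma (in abelian_group) add_minus_cancel:
  "\<lbrakk>x \<in> carrier G; y \<in> carrier G\<rbrakk> \<Longrightarrow> x \<oplus> (y \<oplus> \<ominus> x) = y"
  using a_lcomm[of x y "\<ominus> x"] by (simp add: r_neg)

section \<open>Right ideals and the existence of maximal ones\<close>

lemma right_ideal_eq_carrierI:
  assumes "right_ideal I R" "\<one>\<^bsub>R\<^esub> \<in> I"
  shows "I = carrier R"
proof -
  interpret right_ideal I R by fact
  show ?thesis using a_subset I_r_closed[OF assms(2)] by force
qed

text \<open>Only closure under addition uses comparability: two elements of the union already lie in
  the larger of two members. Nonemptiness of \<open>C\<close> supplies zero.\<close>

lemma (in ring) right_ideal_Union_chain:
  assumes "C \<noteq> {}" and chain: "\<And>I J. \<lbrakk>I \<in> C; J \<in> C\<rbrakk> \<Longrightarrow> I \<subseteq> J \<or> J \<subseteq> I"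
    and ideals: "\<And>I. I \<in> C \<Longrightarrow> right_ideal I R"
  shows "right_ideal (\<Union>C) R"
proof -
  have sub: "additive_subgroup I R" if "I \<in> C" for I
    using ideals[OF that] by (simp add: right_ideal_def)
  have "subgroup (\<Union>C) (add_monoid R)"
  proof (rule add.subgroupI)
    show "\<Union>C \<subseteq> carrier R" using sub additive_subgroup.a_subset by blast
    show "\<Union>C \<noteq> {}" using assms(1) sub additive_subgroup.zero_closed by blast
    show "\<ominus> x \<in> \<Union>C" if "x \<in> \<Union>C" for x
      using that sub additive_subgroup.a_inv_closed abelian_group_axioms by (metis Union_iff)
    show "x \<oplus> y \<in> \<Union>C" if xy: "x \<in> \<Union>C" "y \<in> \<Union>C" for x y
    proof -
      obtain I where I: "I \<in> C" "x \<in> I" "y \<in> I" using xy chain by (meson UnionE subsetD)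
      then have "x \<oplus> y \<in> I" by (intro additive_subgroup.a_closed sub)
      then show ?thesis using I(1) by blast
    qed
  qed
  moreover have "x \<otimes> r \<in> \<Union>C" if x: "x \<in> \<Union>C" and r: "r \<in> carrier R" for x r
  proof -
    obtain I where I: "I \<in> C" "x \<in> I" using x by blast
    then have "x \<otimes> r \<in> I" using right_ideal.I_r_closed[OF ideals] r by blast
    then show ?thesis using I(1) by blast
  qed
  ultimately show ?thesis
    by (intro right_ideal.intro right_ideal_axioms.intro additive_subgroupI ring_axioms)
qed

text \<open>Zorn's lemma for the right ideals that contain \<open>I\<close> and omit 1. Properness
  is expressed as omission of 1 because this property passes to unions of chains.\<close>

lemma (in ring) exists_maximal_right_ideal:
  assumes "right_ideal I R" "\<one> \<notin> I"
  obtains M where "maximal_right_ideal M R" "I \<subseteq> M"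
proof -
  let ?A = "{J. right_ideal J R \<and> I \<subseteq> J \<and> \<one> \<notin> J}"
  have "\<exists>M\<in>?A. \<forall>X\<in>?A. M \<subseteq> X \<longrightarrow> X = M"
  proof (rule subset_Zorn_nonempty)
    show "?A \<noteq> {}" using assms by blast
    show "\<Union>C \<in> ?A" if C: "C \<noteq> {}" "subset.chain ?A C" for C
    proof -
      have "right_ideal (\<Union>C) R"
        by (rule right_ideal_Union_chain) (use C in \<open>auto simp: subset_chain_def\<close>)
      then show ?thesis using C by (auto simp: subset_chain_def)
    qed
  qed
  then obtain M where "M \<in> ?A" and "\<forall>X\<in>?A. M \<subseteq> X \<longrightarrow> X = M" by (rule bexE)
  then have M: "right_ideal M R" "I \<subseteq> M" "\<one> \<notin> M"
    and max: "\<And>X. \<lbrakk>right_ideal X R; I \<subseteq> X; \<one> \<notin> X; M \<subseteq> X\<rbrakk> \<Longrightarrow> X = M" by simp_all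
  have "maximal_right_ideal M R"
  proof (intro maximal_right_ideal.intro maximal_right_ideal_axioms.intro M(1))
    show "carrier R \<noteq> M" using M(3) by auto
    show "J = M \<or> J = carrier R" if J: "right_ideal J R" "M \<subseteq> J" for J
    proof (cases "\<one> \<in> J")
      case True
      then show ?thesis using right_ideal_eq_carrierI J(1) by blast
    next
      case False
      then show ?thesis using max[OF J(1) subset_trans[OF M(2) J(2)] _ J(2)] by simp
    qed
  qed
  then show ?thesis using M(2) by (rule that)
qed

lemma (in ring) right_ideal_principal:
  assumes x: "x \<in> carrier R"
  shows "right_ideal ((\<lambda>r. x \<otimes> r) ` carrier R) R"
proof (intro right_ideal.intro right_ideal_axioms.intro additive_subgroupI ring_axioms
    add.subgroupI)
  show "(\<lambda>r. x \<otimes> r) ` carrier R \<subseteq> carrier R" using x by auto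
  show "(\<lambda>r. x \<otimes> r) ` carrier R \<noteq> {}" by auto
  show "\<ominus> y \<in> (\<lambda>r. x \<otimes> r) ` carrier R" if "y \<in> (\<lambda>r. x \<otimes> r) ` carrier R" for y
    using that x by (auto simp: r_minus[symmetric] intro!: imageI)
  show "y \<oplus> z \<in> (\<lambda>r. x \<otimes> r) ` carrier R"
    if "y \<in> (\<lambda>r. x \<otimes> r) ` carrier R" "z \<in> (\<lambda>r. x \<otimes> r) ` carrier R" for y z
    using that x by (auto simp: r_distr[symmetric] intro!: imageI)
  show "y \<otimes> r \<in> (\<lambda>r. x \<otimes> r) ` carrier R"
    if "y \<in> (\<lambda>r. x \<otimes> r) ` carrier R" "r \<in> carrier R" for y r
    using that x by (auto simp: m_assoc intro!: imageI)
qed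

lemma (in ring) Units_idem_eq_one:
  assumes "e \<in> Units R" "e \<otimes> e = e"
  shows "e = \<one>"
  using assms Units_l_cancel[of e e \<one>] by (simp add: Units_closed)

section \<open>Units and the Jacobson radical of a local ring\<close>

context local_ring
begin

text \<open>The intersection that defines the radical has a single member. The closure properties of
  a right ideal become available for the radical in this way.\<close>

lemma jacobson_radical_maximal: "maximal_right_ideal (jacobson_radical R) R"
proof -
  obtain M where M: "maximal_right_ideal M R" and uniq: "\<And>N. maximal_right_ideal N R \<Longrightarrow> N = M"
    using unique_maximal_right_ideal by blast
  interpret M: maximal_right_ideal M R by fact
  have "jacobson_radical R = M"
    unfolding jacobson_radical_def using M uniq M.a_subset by blast
  then show ?thesis using M by simp
qed

sublocale J: maximal_right_ideal "jacobson_radical R" R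
  by (rule jacobson_radical_maximal)

lemma one_notin_jacobson: "\<one> \<notin> jacobson_radical R"
  using right_ideal_eq_carrierI[OF J.right_ideal_axioms] J.I_notcarr by auto

text \<open>If \<open>xR\<close> omitted 1, it would lie in a maximal right ideal, which can only be
  the radical; but \<open>x\<close> belongs to \<open>xR\<close>.\<close>

lemma right_inverse_exists:
  assumes "x \<in> carrier R" "x \<notin> jacobson_radical R"
  obtains y where "y \<in> carrier R" "x \<otimes> y = \<one>"
proof (cases "\<one> \<in> (\<lambda>r. x \<otimes> r) ` carrier R")
  case True
  then obtain y where "y \<in> carrier R" "x \<otimes> y = \<one>" by auto
  then show ?thesis using that by blast
next
  case False
  then obtain M where M: "maximal_right_ideal M R" "(\<lambda>r. x \<otimes> r) ` carrier R \<subseteq> M"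
    using exists_maximal_right_ideal right_ideal_principal[OF assms(1)] by blast
  have "x \<in> (\<lambda>r. x \<otimes> r) ` carrier R"
    using assms(1) by (intro image_eqI[of _ _ \<one>]) auto
  then have "x \<in> jacobson_radical R"
    using M unique_maximal_right_ideal jacobson_radical_maximal by blast
  then show ?thesis using assms(2) by simp
qed

text \<open>So far the radical is known only as a right ideal, so elements outside it have right
  inverses only. For a right inverse \<open>y\<close> of \<open>x\<close> it is shown that
  \<open>y\<close> lies outside the radical as well; then \<open>y\<close> has inverses on both
  sides, and its right inverse must be \<open>x\<close>.\<close>

lemma Units_eq: "Units R = carrier R - jacobson_radical R"
proof (intro equalityI subsetI)
  fix x assume x: "x \<in> Units R"
  then have "x \<notin> jacobson_radical R"
    using J.I_r_closed[of x "inv x"] one_notin_jacobson by auto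
  then show "x \<in> carrier R - jacobson_radical R" using x by auto
next
  fix x assume x: "x \<in> carrier R - jacobson_radical R"
  then obtain y where y: "y \<in> carrier R" "x \<otimes> y = \<one>" using right_inverse_exists by blast
  have "y \<notin> jacobson_radical R"
  proof
    assume yJ: "y \<in> jacobson_radical R"
    then have yx: "y \<otimes> x \<in> jacobson_radical R" using J.I_r_closed x by auto
    have "\<one> \<ominus> y \<otimes> x \<notin> jacobson_radical R"
    proof
      assume "\<one> \<ominus> y \<otimes> x \<in> jacobson_radical R"
      then have "(\<one> \<ominus> y \<otimes> x) \<oplus> y \<otimes> x \<in> jacobson_radical R" using yx J.a_closed by blast
      then show False
        using x y one_notin_jacobson by (simp add: minus_eq a_assoc l_neg)
    qed
    then obtain z where z: "z \<in> carrier R" "(\<one> \<ominus> y \<otimes> x) \<otimes> z = \<one>"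
      using right_inverse_exists[of "\<one> \<ominus> y \<otimes> x"] x y by auto
    \<comment> \<open>Since \<open>xy = 1\<close>, the product is \<open>x - (xy)x = 0\<close>.
      Multiplying on the right by \<open>z\<close> then gives \<open>x = 0\<close>, although
      \<open>x\<close> lies outside the radical.\<close>
    have "x \<otimes> (\<one> \<ominus> y \<otimes> x) = \<zero>"
      using x y by (simp add: minus_eq r_distr r_minus m_assoc[symmetric] r_neg)
    then have "x = \<zero>"
      using x y z by (metis DiffD1 l_null m_assoc minus_closed m_closed one_closed r_one)
    then show False using x J.zero_closed by auto
  qed
  then obtain z where z: "z \<in> carrier R" "y \<otimes> z = \<one>" using right_inverse_exists y by blast
  have "z = x" using x y z by (metis DiffD1 l_one m_assoc r_one)
  then show "x \<in> Units R" using x y z unfolding Units_def by auto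
qed

text \<open>If \<open>e\<close> were in the radical, so would be \<open>a - e\<close>, which is a
  unit. For an idempotent \<open>e\<close> this will force \<open>e = 1\<close>.\<close>

lemma Units_jacobson_minus:
  assumes "a \<in> jacobson_radical R" "e \<in> carrier R" "a \<ominus> e \<in> Units R"
  shows "e \<in> Units R"
proof -
  have "e \<notin> jacobson_radical R"
    using assms J.a_closed[OF assms(1)] J.a_inv_closed
    by (auto simp: Units_eq minus_eq)
  then show ?thesis using assms(2) by (simp add: Units_eq)
qed

text \<open>Otherwise 1, being the difference of \<open>a\<close> and \<open>a - 1\<close>, would
  lie in the radical.\<close>

lemma jacobson_minus_one_Units:
  assumes "a \<in> jacobson_radical R"
  shows "a \<ominus> \<one> \<in> Units R"
proof -
  have a: "a \<in> carrier R" using assms J.a_subset by blast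
  have "a \<ominus> \<one> \<notin> jacobson_radical R"
  proof
    assume "a \<ominus> \<one> \<in> jacobson_radical R"
    then have "\<ominus> (a \<ominus> \<one>) \<oplus> a \<in> jacobson_radical R"
      using assms J.a_closed J.a_inv_closed by blast
    then show False using a one_notin_jacobson by (simp add: minus_eq minus_add a_ac add_minus_cancel)
  qed
  then show ?thesis using a by (simp add: Units_eq)
qed

text \<open>Translates the coset \<open>1 + J\<close> into the difference form in which all later
  arguments are stated.\<close>

lemma one_coset_jacobson_iff:
  assumes "b \<in> carrier R"
  shows "b \<in> \<one> <+ jacobson_radical R \<longleftrightarrow> b \<ominus> \<one> \<in> jacobson_radical R"
proof
  assume "b \<in> \<one> <+ jacobson_radical R"
  then obtain j where "j \<in> jacobson_radical R" "j \<in> carrier R" "b = \<one> \<oplus> j"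
    using J.a_subset by (auto simp: a_l_coset_def')
  then show "b \<ominus> \<one> \<in> jacobson_radical R"
    by (simp add: minus_eq a_ac r_neg)
next
  assume "b \<ominus> \<one> \<in> jacobson_radical R"
  moreover have "b = \<one> \<oplus> (b \<ominus> \<one>)"
    using assms by (simp add: minus_eq a_ac add_minus_cancel r_neg)
  ultimately show "b \<in> \<one> <+ jacobson_radical R" by (auto simp: a_l_coset_def')
qed

lemma one_minus_in_jacobson_iff:
  assumes "a \<in> carrier R"
  shows "\<one> \<ominus> a \<in> jacobson_radical R \<longleftrightarrow> a \<ominus> \<one> \<in> jacobson_radical R"
proof -
  have "\<one> \<ominus> a = \<ominus> (a \<ominus> \<one>)" "a \<ominus> \<one> = \<ominus> (\<one> \<ominus> a)"
    using assms by (simp_all add: minus_eq minus_add a_ac)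
  then show ?thesis using J.a_inv_closed by metis
qed

text \<open>Writing \<open>b - e\<close> as \<open>(b - 1) - (e - 1)\<close> shows that
  \<open>e - 1\<close> is a unit, and it annihilates \<open>e\<close> because \<open>e\<close> is
  idempotent.\<close>

lemma idem_eq_zero:
  assumes b: "b \<in> carrier R" "b \<ominus> \<one> \<in> jacobson_radical R"
    and e: "e \<in> carrier R" "e \<otimes> e = e" "b \<ominus> e \<in> Units R"
  shows "e = \<zero>"
proof -
  have "b \<ominus> e = (b \<ominus> \<one>) \<ominus> (e \<ominus> \<one>)"
    using b(1) e(1) by (simp add: minus_eq minus_add a_ac add_minus_cancel)
  then have "e \<ominus> \<one> \<in> Units R" using Units_jacobson_minus b e by simp
  moreover have "(e \<ominus> \<one>) \<otimes> e = (e \<ominus> \<one>) \<otimes> \<zero>"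
    using e by (simp add: minus_eq l_distr l_minus r_neg)
  ultimately show ?thesis using e(1) Units_l_cancel zero_closed by blast
qed

end

section \<open>The map \<open>sylvester a b\<close> on a bimodule\<close>

context bimodule
begin

definition
  "sylvester a b x = a \<odot>\<^bsub>V\<^esub> x \<ominus>\<^bsub>V\<^esub> x \<triangleleft>\<^bsub>V\<^esub> b"

lemma sylvester_closed [simp]:
  "\<lbrakk>a \<in> carrier R; b \<in> carrier S; x \<in> carrier V\<rbrakk> \<Longrightarrow> sylvester a b x \<in> carrier V"
  by (simp add: sylvester_def lsmult_closed rsmult_closed)

lemma lsmult_minus:
  assumes "r \<in> carrier R" "x \<in> carrier V"
  shows "r \<odot>\<^bsub>V\<^esub> (\<ominus>\<^bsub>V\<^esub> x) = \<ominus>\<^bsub>V\<^esub> (r \<odot>\<^bsub>V\<^esub> x)"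
proof -
  have "r \<odot>\<^bsub>V\<^esub> (\<ominus>\<^bsub>V\<^esub> x) \<oplus>\<^bsub>V\<^esub> r \<odot>\<^bsub>V\<^esub> x = \<zero>\<^bsub>V\<^esub>"
    using assms by (simp add: lsmult_distr_vector[symmetric] V.l_neg lsmult_zero)
  then show ?thesis using assms by (simp add: V.minus_equality lsmult_closed)
qed

lemma rsmult_minus:
  assumes "s \<in> carrier S" "x \<in> carrier V"
  shows "(\<ominus>\<^bsub>V\<^esub> x) \<triangleleft>\<^bsub>V\<^esub> s = \<ominus>\<^bsub>V\<^esub> (x \<triangleleft>\<^bsub>V\<^esub> s)"
proof -
  have "(\<ominus>\<^bsub>V\<^esub> x) \<triangleleft>\<^bsub>V\<^esub> s \<oplus>\<^bsub>V\<^esub> x \<triangleleft>\<^bsub>V\<^esub> s = \<zero>\<^bsub>V\<^esub>"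
    using assms by (simp add: rsmult_distr_vector[symmetric] V.l_neg rsmult_zero)
  then show ?thesis using assms by (simp add: V.minus_equality rsmult_closed)
qed

lemma zero_lsmult: "x \<in> carrier V \<Longrightarrow> \<zero>\<^bsub>R\<^esub> \<odot>\<^bsub>V\<^esub> x = \<zero>\<^bsub>V\<^esub>"
  using lsmult_distr_scalar[of "\<zero>\<^bsub>R\<^esub>" "\<zero>\<^bsub>R\<^esub>" x] lsmult_closed[of "\<zero>\<^bsub>R\<^esub>" x]
  by (simp add: V.add.r_cancel_one')

lemma rsmult_by_zero: "x \<in> carrier V \<Longrightarrow> x \<triangleleft>\<^bsub>V\<^esub> \<zero>\<^bsub>S\<^esub> = \<zero>\<^bsub>V\<^esub>"
  using rsmult_distr_scalar[of "\<zero>\<^bsub>S\<^esub>" "\<zero>\<^bsub>S\<^esub>" x] rsmult_closed[of "\<zero>\<^bsub>S\<^esub>" x]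
  by (simp add: V.add.r_cancel_one')

lemma minus_lsmult:
  assumes "r \<in> carrier R" "x \<in> carrier V"
  shows "(\<ominus>\<^bsub>R\<^esub> r) \<odot>\<^bsub>V\<^esub> x = \<ominus>\<^bsub>V\<^esub> (r \<odot>\<^bsub>V\<^esub> x)"
proof -
  have "(\<ominus>\<^bsub>R\<^esub> r) \<odot>\<^bsub>V\<^esub> x \<oplus>\<^bsub>V\<^esub> r \<odot>\<^bsub>V\<^esub> x = \<zero>\<^bsub>V\<^esub>"
    using assms by (simp add: lsmult_distr_scalar[symmetric] R.l_neg zero_lsmult)
  then show ?thesis using assms by (simp add: V.minus_equality lsmult_closed)
qed

lemma rsmult_by_minus:
  assumes "s \<in> carrier S" "x \<in> carrier V"
  shows "x \<triangleleft>\<^bsub>V\<^esub> (\<ominus>\<^bsub>S\<^esub> s) = \<ominus>\<^bsub>V\<^esub> (x \<triangleleft>\<^bsub>V\<^esub> s)"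
proof -
  have "x \<triangleleft>\<^bsub>V\<^esub> (\<ominus>\<^bsub>S\<^esub> s) \<oplus>\<^bsub>V\<^esub> x \<triangleleft>\<^bsub>V\<^esub> s = \<zero>\<^bsub>V\<^esub>"
    using assms by (simp add: rsmult_distr_scalar[symmetric] S.l_neg rsmult_by_zero)
  then show ?thesis using assms by (simp add: V.minus_equality rsmult_closed)
qed

lemma sylvester_zero [simp]:
  "\<lbrakk>a \<in> carrier R; b \<in> carrier S\<rbrakk> \<Longrightarrow> sylvester a b \<zero>\<^bsub>V\<^esub> = \<zero>\<^bsub>V\<^esub>"
  by (simp add: sylvester_def lsmult_zero rsmult_zero V.minus_eq)

lemma sylvester_one_zero [simp]: "v \<in> carrier V \<Longrightarrow> sylvester \<one>\<^bsub>R\<^esub> \<zero>\<^bsub>S\<^esub> v = v"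
  by (simp add: sylvester_def lsmult_one rsmult_by_zero V.minus_eq)

lemma sylvester_zero_one [simp]: "v \<in> carrier V \<Longrightarrow> sylvester \<zero>\<^bsub>R\<^esub> \<one>\<^bsub>S\<^esub> v = \<ominus>\<^bsub>V\<^esub> v"
  by (simp add: sylvester_def zero_lsmult rsmult_one V.minus_eq)

lemma sylvester_zero_zero [simp]: "v \<in> carrier V \<Longrightarrow> sylvester \<zero>\<^bsub>R\<^esub> \<zero>\<^bsub>S\<^esub> v = \<zero>\<^bsub>V\<^esub>"
  by (simp add: sylvester_def zero_lsmult rsmult_by_zero V.minus_eq)

text \<open>The contributions \<open>x\<close> and \<open>-x\<close> of the two identities
  cancel.\<close>

lemma sylvester_one_minus:
  assumes "a \<in> carrier R" "b \<in> carrier S" "x \<in> carrier V"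
  shows "sylvester (\<one>\<^bsub>R\<^esub> \<ominus>\<^bsub>R\<^esub> a) (\<one>\<^bsub>S\<^esub> \<ominus>\<^bsub>S\<^esub> b) x = \<ominus>\<^bsub>V\<^esub> sylvester a b x"
  using assms lsmult_closed[OF assms(1,3)] rsmult_closed[OF assms(2,3)]
  by (simp add: sylvester_def V.minus_eq R.minus_eq S.minus_eq lsmult_distr_scalar
      rsmult_distr_scalar minus_lsmult rsmult_by_minus lsmult_one rsmult_one
      V.minus_add V.a_ac V.r_neg1 V.r_neg2)

text \<open>Left actions of commuting scalars commute, right actions likewise, and every left action
  commutes with every right action by \<open>smult_compat\<close>.\<close>

lemma sylvester_commute:
  assumes "a \<in> carrier R" "b \<in> carrier S" "r \<in> carrier R" "s \<in> carrier S" "x \<in> carrier V"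
    and "r \<otimes>\<^bsub>R\<^esub> a = a \<otimes>\<^bsub>R\<^esub> r" "s \<otimes>\<^bsub>S\<^esub> b = b \<otimes>\<^bsub>S\<^esub> s"
  shows "sylvester a b (sylvester r s x) = sylvester r s (sylvester a b x)"
proof -
  have "a \<odot>\<^bsub>V\<^esub> (r \<odot>\<^bsub>V\<^esub> x) = r \<odot>\<^bsub>V\<^esub> (a \<odot>\<^bsub>V\<^esub> x)"
    using assms lsmult_assoc by metis
  moreover have "x \<triangleleft>\<^bsub>V\<^esub> s \<triangleleft>\<^bsub>V\<^esub> b = x \<triangleleft>\<^bsub>V\<^esub> b \<triangleleft>\<^bsub>V\<^esub> s"
    using assms rsmult_assoc by metis
  ultimately show ?thesis
    using assms(1-5)
    by (simp add: sylvester_def V.minus_eq lsmult_distr_vector rsmult_distr_vector lsmult_minus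
        rsmult_minus lsmult_closed rsmult_closed smult_compat V.minus_add V.a_ac)
qed

section \<open>Commutation, double commutants and units in the triangular ring\<close>

lemma triangular_commute_iff:
  assumes "a \<in> carrier R" "b \<in> carrier S" "v \<in> carrier V"
    and "r \<in> carrier R" "s \<in> carrier S" "y \<in> carrier V"
  shows "(r, y, s) \<otimes>\<^bsub>triangular_ring R V S\<^esub> (a, v, b) =
      (a, v, b) \<otimes>\<^bsub>triangular_ring R V S\<^esub> (r, y, s) \<longleftrightarrow>
    r \<otimes>\<^bsub>R\<^esub> a = a \<otimes>\<^bsub>R\<^esub> r \<and> s \<otimes>\<^bsub>S\<^esub> b = b \<otimes>\<^bsub>S\<^esub> s \<and> sylvester r s v = sylvester a b y"
proof -
  \<comment> \<open>The upper right entries of the two products give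
    \<open>rv + yb = ay + vs\<close>; exchanging \<open>yb\<close> and \<open>vs\<close> between the
    sides turns this into \<open>rv - vs = ay - yb\<close>.\<close>
  have swap: "p \<oplus>\<^bsub>V\<^esub> q = p' \<oplus>\<^bsub>V\<^esub> q' \<longleftrightarrow> p \<ominus>\<^bsub>V\<^esub> q' = p' \<ominus>\<^bsub>V\<^esub> q"
    if [simp]: "p \<in> carrier V" "q \<in> carrier V" "p' \<in> carrier V" "q' \<in> carrier V" for p q p' q'
  proof -
    have "p \<oplus>\<^bsub>V\<^esub> q = p' \<oplus>\<^bsub>V\<^esub> q' \<longleftrightarrow>
        (p \<oplus>\<^bsub>V\<^esub> q) \<oplus>\<^bsub>V\<^esub> (\<ominus>\<^bsub>V\<^esub> q \<oplus>\<^bsub>V\<^esub> \<ominus>\<^bsub>V\<^esub> q') = (p' \<oplus>\<^bsub>V\<^esub> q') \<oplus>\<^bsub>V\<^esub> (\<ominus>\<^bsub>V\<^esub> q \<oplus>\<^bsub>V\<^esub> \<ominus>\<^bsub>V\<^esub> q')"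
      by simp
    also have "(p \<oplus>\<^bsub>V\<^esub> q) \<oplus>\<^bsub>V\<^esub> (\<ominus>\<^bsub>V\<^esub> q \<oplus>\<^bsub>V\<^esub> \<ominus>\<^bsub>V\<^esub> q') = p \<ominus>\<^bsub>V\<^esub> q'"
      by (simp add: V.minus_eq V.a_assoc V.r_neg2)
    also have "(p' \<oplus>\<^bsub>V\<^esub> q') \<oplus>\<^bsub>V\<^esub> (\<ominus>\<^bsub>V\<^esub> q \<oplus>\<^bsub>V\<^esub> \<ominus>\<^bsub>V\<^esub> q') = p' \<ominus>\<^bsub>V\<^esub> q"
      by (simp add: V.minus_eq V.a_ac V.r_neg2)
    finally show ?thesis .
  qed
  show ?thesis
    using assms
    by (auto simp: triangular_ring_def sylvester_def swap lsmult_closed rsmult_closed)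
qed

text \<open>Centrality of \<open>p\<close> and \<open>q\<close> settles the diagonal and covers both
  pairs (1, 0) and (0, 1). For the corner, \<open>D(p,q) y = D(r,s) x\<close> is needed; both sides
  have the same image under \<open>D(a,b)\<close>, so injectivity suffices.\<close>

lemma triangular_mem_comm2I:
  assumes inj: "inj_on (sylvester a b) (carrier V)"
    and "a \<in> carrier R" "b \<in> carrier S" "v \<in> carrier V"
    and "p \<in> carrier R" "q \<in> carrier S" "x \<in> carrier V"
    and p: "\<And>r. r \<in> carrier R \<Longrightarrow> p \<otimes>\<^bsub>R\<^esub> r = r \<otimes>\<^bsub>R\<^esub> p"
    and q: "\<And>s. s \<in> carrier S \<Longrightarrow> q \<otimes>\<^bsub>S\<^esub> s = s \<otimes>\<^bsub>S\<^esub> q"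
    and x: "sylvester a b x = sylvester p q v"
  shows "(p, x, q) \<in> comm2 (triangular_ring R V S) (a, v, b)"
  unfolding comm2_def
proof (intro CollectI conjI ballI)
  show "(p, x, q) \<in> carrier (triangular_ring R V S)"
    using assms by (simp add: triangular_ring_def)
  fix m assume "m \<in> comm (triangular_ring R V S) (a, v, b)"
  then obtain r y s where m: "m = (r, y, s)"
    and c: "r \<in> carrier R" "y \<in> carrier V" "s \<in> carrier S"
    and eq: "(r, y, s) \<otimes>\<^bsub>triangular_ring R V S\<^esub> (a, v, b) =
      (a, v, b) \<otimes>\<^bsub>triangular_ring R V S\<^esub> (r, y, s)"
    by (cases m) (auto simp: comm_def triangular_ring_def)
  have ra: "r \<otimes>\<^bsub>R\<^esub> a = a \<otimes>\<^bsub>R\<^esub> r" and sb: "s \<otimes>\<^bsub>S\<^esub> b = b \<otimes>\<^bsub>S\<^esub> s"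
    and y: "sylvester r s v = sylvester a b y"
    using eq assms c by (auto simp: triangular_commute_iff)
  have "sylvester a b (sylvester p q y) = sylvester p q (sylvester r s v)"
    using assms c by (simp add: sylvester_commute y)
  also have "\<dots> = sylvester r s (sylvester a b x)"
    using sylvester_commute[of r s p q v] assms c by (simp add: x)
  also have "\<dots> = sylvester a b (sylvester r s x)"
    by (rule sylvester_commute) (use assms c ra sb in auto)
  finally have "sylvester p q y = sylvester r s x"
    using inj assms c by (auto dest: inj_onD)
  then show "(p, x, q) \<otimes>\<^bsub>triangular_ring R V S\<^esub> m = m \<otimes>\<^bsub>triangular_ring R V S\<^esub> (p, x, q)"
    using assms c by (simp add: m triangular_commute_iff)
qed

lemma triangular_minus:
  assumes "a \<in> carrier R" "b \<in> carrier S" "v \<in> carrier V"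
    and "r \<in> carrier R" "s \<in> carrier S" "y \<in> carrier V"
  shows "(a, v, b) \<ominus>\<^bsub>triangular_ring R V S\<^esub> (r, y, s) =
    (a \<ominus>\<^bsub>R\<^esub> r, v \<ominus>\<^bsub>V\<^esub> y, b \<ominus>\<^bsub>S\<^esub> s)"
proof -
  interpret T: ring "triangular_ring R V S" by (rule ring_triangular_ring)
  have "\<ominus>\<^bsub>triangular_ring R V S\<^esub> (r, y, s) = (\<ominus>\<^bsub>R\<^esub> r, \<ominus>\<^bsub>V\<^esub> y, \<ominus>\<^bsub>S\<^esub> s)"
    by (rule T.minus_equality)
      (use assms in \<open>auto simp: triangular_ring_def R.l_neg S.l_neg V.l_neg\<close>)
  then show ?thesis
    by (simp add: T.minus_eq R.minus_eq S.minus_eq V.minus_eq) (simp add: triangular_ring_def)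
qed

lemma triangular_Units_iff:
  assumes "v \<in> carrier V"
  shows "(r, v, s) \<in> Units (triangular_ring R V S) \<longleftrightarrow> r \<in> Units R \<and> s \<in> Units S"
proof
  assume "(r, v, s) \<in> Units (triangular_ring R V S)"
  then show "r \<in> Units R \<and> s \<in> Units S"
    by (auto simp: Units_def triangular_ring_def)
next
  assume "r \<in> Units R \<and> s \<in> Units S"
  then have rs: "r \<in> Units R" "s \<in> Units S" by auto
  let ?r = "inv\<^bsub>R\<^esub> r" and ?s = "inv\<^bsub>S\<^esub> s"
  have [simp]: "r \<in> carrier R" "s \<in> carrier S" "?r \<in> carrier R" "?s \<in> carrier S"
    "r \<otimes>\<^bsub>R\<^esub> ?r = \<one>\<^bsub>R\<^esub>" "?r \<otimes>\<^bsub>R\<^esub> r = \<one>\<^bsub>R\<^esub>" "s \<otimes>\<^bsub>S\<^esub> ?s = \<one>\<^bsub>S\<^esub>" "?s \<otimes>\<^bsub>S\<^esub> s = \<one>\<^bsub>S\<^esub>"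
    using rs by auto
  \<comment> \<open>The corner of the inverse matrix: it solves both \<open>r w + v ?s = 0\<close>
    and \<open>?r v + w s = 0\<close>.\<close>
  define w where "w = \<ominus>\<^bsub>V\<^esub> (?r \<odot>\<^bsub>V\<^esub> (v \<triangleleft>\<^bsub>V\<^esub> ?s))"
  have w: "w \<in> carrier V" using assms by (simp add: w_def lsmult_closed rsmult_closed)
  have "r \<odot>\<^bsub>V\<^esub> w = \<ominus>\<^bsub>V\<^esub> (v \<triangleleft>\<^bsub>V\<^esub> ?s)"
    using assms by (simp add: w_def lsmult_minus lsmult_closed rsmult_closed
        lsmult_assoc[symmetric] lsmult_one)
  moreover have "w \<triangleleft>\<^bsub>V\<^esub> s = \<ominus>\<^bsub>V\<^esub> (?r \<odot>\<^bsub>V\<^esub> v)"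
    using assms by (simp add: w_def rsmult_minus lsmult_closed rsmult_closed smult_compat
        rsmult_assoc[symmetric] rsmult_one)
  ultimately show "(r, v, s) \<in> Units (triangular_ring R V S)"
    unfolding Units_def
    by (intro CollectI conjI bexI[of _ "(?r, w, ?s)"])
      (use assms w in \<open>simp_all add: triangular_ring_def lsmult_closed rsmult_closed
        V.l_neg V.r_neg\<close>)
qed

section \<open>From perfect cleanness to unique solvability\<close>

lemma sylvester_unique_solution:
  assumes "local_ring R" "local_ring S"
    and clean: "perfectly_clean_ring (triangular_ring R V S)"
    and a: "a \<in> carrier R" "a \<in> jacobson_radical R"
    and b: "b \<in> carrier S" "b \<ominus>\<^bsub>S\<^esub> \<one>\<^bsub>S\<^esub> \<in> jacobson_radical S"
    and v: "v \<in> carrier V"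
  shows "\<exists>!x. x \<in> carrier V \<and> sylvester a b x = v"
proof -
  interpret LR: local_ring R by fact
  interpret LS: local_ring S by fact
  interpret T: perfectly_clean_ring "triangular_ring R V S" by fact
  \<comment> \<open>The corner \<open>u\<close> stays free: existence of a solution takes
    \<open>u = v\<close>, uniqueness takes \<open>u = 0\<close>.\<close>
  have idem: "\<exists>x\<in>carrier V. (\<one>\<^bsub>R\<^esub>, x, \<zero>\<^bsub>S\<^esub>) \<in> comm2 (triangular_ring R V S) (a, u, b)"
    if u: "u \<in> carrier V" for u
  proof -
    have "(a, u, b) \<in> carrier (triangular_ring R V S)"
      using a b u by (simp add: triangular_ring_def)
    then obtain m where m: "m \<in> comm2 (triangular_ring R V S) (a, u, b)"
      "m \<otimes>\<^bsub>triangular_ring R V S\<^esub> m = m"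
      "(a, u, b) \<ominus>\<^bsub>triangular_ring R V S\<^esub> m \<in> Units (triangular_ring R V S)"
      using T.perfectly_clean by blast
    obtain e x f where efx: "m = (e, x, f)" "e \<in> carrier R" "x \<in> carrier V" "f \<in> carrier S"
      using m(1) by (cases m) (auto simp: comm2_def triangular_ring_def)
    have "e \<otimes>\<^bsub>R\<^esub> e = e" "f \<otimes>\<^bsub>S\<^esub> f = f"
      using m(2) by (auto simp: efx(1) triangular_ring_def)
    moreover have "a \<ominus>\<^bsub>R\<^esub> e \<in> Units R" "b \<ominus>\<^bsub>S\<^esub> f \<in> Units S"
      using m(3) a b u efx by (auto simp: triangular_minus triangular_Units_iff)
    ultimately have "e = \<one>\<^bsub>R\<^esub>" "f = \<zero>\<^bsub>S\<^esub>"
      using R.Units_idem_eq_one[OF LR.Units_jacobson_minus[OF a(2) efx(2)]]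
        LS.idem_eq_zero[OF b efx(4)] by simp_all
    then show ?thesis using m(1) efx by auto
  qed
  \<comment> \<open>A matrix lies in its own commutant, so the idempotent commutes with it; for the
    corners this says \<open>D(a,b) x = D(1,0) v = v\<close>.\<close>
  have ex: "\<exists>x\<in>carrier V. sylvester a b x = v"
  proof -
    obtain x where x: "x \<in> carrier V" "(\<one>\<^bsub>R\<^esub>, x, \<zero>\<^bsub>S\<^esub>) \<in> comm2 (triangular_ring R V S) (a, v, b)"
      using idem v by blast
    moreover have "(a, v, b) \<in> comm (triangular_ring R V S) (a, v, b)"
      using a b v by (simp add: comm_def triangular_ring_def)
    ultimately show ?thesis
      using a b v by (force simp: comm2_def triangular_commute_iff)
  qed
  have ker: "w = \<zero>\<^bsub>V\<^esub>" if w: "w \<in> carrier V" "sylvester a b w = \<zero>\<^bsub>V\<^esub>" for w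
  proof -
    obtain x where x: "x \<in> carrier V"
      "(\<one>\<^bsub>R\<^esub>, x, \<zero>\<^bsub>S\<^esub>) \<in> comm2 (triangular_ring R V S) (a, \<zero>\<^bsub>V\<^esub>, b)"
      using idem by blast
    have "(\<zero>\<^bsub>R\<^esub>, w, \<zero>\<^bsub>S\<^esub>) \<in> carrier (triangular_ring R V S)"
      using w by (simp add: triangular_ring_def)
    then have "(\<zero>\<^bsub>R\<^esub>, w, \<zero>\<^bsub>S\<^esub>) \<in> comm (triangular_ring R V S) (a, \<zero>\<^bsub>V\<^esub>, b)"
      using a b w by (simp add: comm_def triangular_commute_iff)
    \<comment> \<open>The corner condition for (1, x, 0) to commute with (0, w, 0): the left side is
      \<open>w\<close>, the right side is zero.\<close>
    then have "sylvester \<one>\<^bsub>R\<^esub> \<zero>\<^bsub>S\<^esub> w = sylvester \<zero>\<^bsub>R\<^esub> \<zero>\<^bsub>S\<^esub> x"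
      using x w by (auto simp: comm2_def triangular_commute_iff)
    then show ?thesis using x w by simp
  qed
  have diff: "sylvester a b (x \<ominus>\<^bsub>V\<^esub> y) = sylvester a b x \<ominus>\<^bsub>V\<^esub> sylvester a b y"
    if "x \<in> carrier V" "y \<in> carrier V" for x y
    using that a(1) b(1)
    by (simp add: sylvester_def V.minus_eq lsmult_distr_vector rsmult_distr_vector lsmult_minus
        rsmult_minus lsmult_closed rsmult_closed V.minus_add V.a_ac)
  have "x = y" if "x \<in> carrier V" "y \<in> carrier V" "sylvester a b x = v" "sylvester a b y = v" for x y
  proof -
    have "x \<ominus>\<^bsub>V\<^esub> y = \<zero>\<^bsub>V\<^esub>"
      using that v a b by (intro ker[OF V.minus_closed]) (simp_all add: diff V.r_neg V.minus_eq[of v v])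
    then show ?thesis
      using that V.minus_equality[of x "\<ominus>\<^bsub>V\<^esub> y"] by (simp add: V.minus_eq)
  qed
  then show ?thesis using ex by blast
qed

section \<open>From unique solvability to perfect cleanness\<close>

lemma perfectly_clean_triangular:
  assumes "local_ring R" "local_ring S"
    and solve: "\<And>a b v. \<lbrakk>a \<in> carrier R; b \<in> carrier S; a \<in> jacobson_radical R;
        b \<ominus>\<^bsub>S\<^esub> \<one>\<^bsub>S\<^esub> \<in> jacobson_radical S; v \<in> carrier V\<rbrakk> \<Longrightarrow>
      \<exists>!x. x \<in> carrier V \<and> sylvester a b x = v"
  shows "perfectly_clean_ring (triangular_ring R V S)"
proof (intro perfectly_clean_ring.intro perfectly_clean_ring_axioms.intro ring_triangular_ring)
  interpret LR: local_ring R by fact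
  interpret LS: local_ring S by fact
  let ?T = "triangular_ring R V S"
  interpret T: ring ?T by (rule ring_triangular_ring)
  fix m assume m: "m \<in> carrier ?T"
  then obtain a v b where avb: "m = (a, v, b)"
    and c: "a \<in> carrier R" "v \<in> carrier V" "b \<in> carrier S"
    by (auto simp: triangular_ring_def)
  \<comment> \<open>In a local ring an element that is not a unit lies in the radical and becomes a
    unit after subtracting 1. If neither 0 nor 1 works for both diagonal entries at once, one entry
    is in the radical and the other in 1 plus the radical.\<close>
  consider "a \<in> Units R" "b \<in> Units S"
    | "a \<ominus>\<^bsub>R\<^esub> \<one>\<^bsub>R\<^esub> \<in> Units R" "b \<ominus>\<^bsub>S\<^esub> \<one>\<^bsub>S\<^esub> \<in> Units S"
    | "a \<in> jacobson_radical R" "b \<ominus>\<^bsub>S\<^esub> \<one>\<^bsub>S\<^esub> \<in> jacobson_radical S"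
    | "a \<ominus>\<^bsub>R\<^esub> \<one>\<^bsub>R\<^esub> \<in> jacobson_radical R" "b \<in> jacobson_radical S"
    using c LR.jacobson_minus_one_Units LS.jacobson_minus_one_Units
    by (auto simp: LR.Units_eq LS.Units_eq)
  then show "\<exists>e\<in>comm2 ?T m. e \<otimes>\<^bsub>?T\<^esub> e = e \<and> m \<ominus>\<^bsub>?T\<^esub> e \<in> Units ?T"
  proof cases
    case 1
    then have "m \<ominus>\<^bsub>?T\<^esub> \<zero>\<^bsub>?T\<^esub> \<in> Units ?T"
      using m c by (simp add: T.minus_eq) (simp add: avb triangular_Units_iff)
    then show ?thesis
      by (intro bexI[of _ "\<zero>\<^bsub>?T\<^esub>"]) (auto simp: comm2_def comm_def)
  next
    case 2
    have "m \<ominus>\<^bsub>?T\<^esub> \<one>\<^bsub>?T\<^esub> = (a \<ominus>\<^bsub>R\<^esub> \<one>\<^bsub>R\<^esub>, v \<ominus>\<^bsub>V\<^esub> \<zero>\<^bsub>V\<^esub>, b \<ominus>\<^bsub>S\<^esub> \<one>\<^bsub>S\<^esub>)"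
      using c triangular_minus[of a b v "\<one>\<^bsub>R\<^esub>" "\<one>\<^bsub>S\<^esub>" "\<zero>\<^bsub>V\<^esub>"]
      by (simp add: avb triangular_ring_def)
    then have "m \<ominus>\<^bsub>?T\<^esub> \<one>\<^bsub>?T\<^esub> \<in> Units ?T"
      using 2 c by (simp add: triangular_Units_iff)
    then show ?thesis
      by (intro bexI[of _ "\<one>\<^bsub>?T\<^esub>"]) (auto simp: comm2_def comm_def)
  next
    case 3
    \<comment> \<open>Uniqueness of the solution for a right-hand side of the form
      \<open>D(a,b) z\<close>.\<close>
    have inj: "inj_on (sylvester a b) (carrier V)"
      using solve[OF c(1,3) 3] c by (metis inj_onI sylvester_closed)
    obtain x where x: "x \<in> carrier V" "sylvester a b x = v" using solve 3 c by blast
    let ?e = "(\<one>\<^bsub>R\<^esub>, x, \<zero>\<^bsub>S\<^esub>)"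
    have "?e \<in> comm2 ?T m"
      unfolding avb by (rule triangular_mem_comm2I[OF inj]) (use c x in auto)
    moreover have "?e \<otimes>\<^bsub>?T\<^esub> ?e = ?e"
      using x by (simp add: triangular_ring_def lsmult_one rsmult_by_zero)
    moreover have "b \<in> Units S"
    proof -
      have "b \<ominus>\<^bsub>S\<^esub> \<one>\<^bsub>S\<^esub> \<notin> Units S" using 3 by (simp add: LS.Units_eq)
      then show ?thesis using c LS.jacobson_minus_one_Units by (auto simp: LS.Units_eq)
    qed
    then have "m \<ominus>\<^bsub>?T\<^esub> ?e \<in> Units ?T"
      using 3 c x LR.jacobson_minus_one_Units
      by (simp add: avb triangular_minus triangular_Units_iff) (simp add: S.minus_eq)
    ultimately show ?thesis by blast
  next
    case 4
    \<comment> \<open>Passing to \<open>1 - a\<close> and \<open>1 - b\<close> puts the first entry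
      into the radical and the second into 1 plus the radical, so \<open>solve\<close>
      applies.\<close>
    let ?a = "\<one>\<^bsub>R\<^esub> \<ominus>\<^bsub>R\<^esub> a" and ?b = "\<one>\<^bsub>S\<^esub> \<ominus>\<^bsub>S\<^esub> b"
    have "?b \<ominus>\<^bsub>S\<^esub> \<one>\<^bsub>S\<^esub> = \<ominus>\<^bsub>S\<^esub> b"
      using c by (simp add: S.minus_eq S.a_ac S.add_minus_cancel)
    then have "\<exists>!x. x \<in> carrier V \<and> sylvester ?a ?b x = u" if "u \<in> carrier V" for u
      using 4 c that LR.one_minus_in_jacobson_iff LS.J.a_inv_closed
      by (intro solve) auto
    then have solve': "\<exists>!x. x \<in> carrier V \<and> \<ominus>\<^bsub>V\<^esub> sylvester a b x = u" if "u \<in> carrier V" for u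
      using that c by (simp add: sylvester_one_minus cong: conj_cong)
    have inj: "inj_on (sylvester a b) (carrier V)"
    proof (rule inj_onI)
      fix y z assume yz: "y \<in> carrier V" "z \<in> carrier V" "sylvester a b y = sylvester a b z"
      then show "y = z"
        using solve'[of "\<ominus>\<^bsub>V\<^esub> sylvester a b z"] c by (metis V.a_inv_closed sylvester_closed)
    qed
    obtain x where x: "x \<in> carrier V" "\<ominus>\<^bsub>V\<^esub> sylvester a b x = v" using solve'[OF c(2)] by (elim ex1E conjE)
    \<comment> \<open>Here \<open>-v\<close> is \<open>D(0,1) v\<close>, the value required for an
      idempotent with diagonal (0, 1).\<close>
    then have x': "sylvester a b x = \<ominus>\<^bsub>V\<^esub> v" using V.minus_minus[of "sylvester a b x"] c by simp
    let ?e = "(\<zero>\<^bsub>R\<^esub>, x, \<one>\<^bsub>S\<^esub>)"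
    have "?e \<in> comm2 ?T m"
      unfolding avb by (rule triangular_mem_comm2I[OF inj]) (use c x x' in auto)
    moreover have "?e \<otimes>\<^bsub>?T\<^esub> ?e = ?e"
      using x by (simp add: triangular_ring_def rsmult_one zero_lsmult)
    moreover have "a \<in> Units R"
    proof -
      have "a \<ominus>\<^bsub>R\<^esub> \<one>\<^bsub>R\<^esub> \<notin> Units R" using 4 by (simp add: LR.Units_eq)
      then show ?thesis using c LR.jacobson_minus_one_Units by (auto simp: LR.Units_eq)
    qed
    then have "m \<ominus>\<^bsub>?T\<^esub> ?e \<in> Units ?T"
      using 4 c x LS.jacobson_minus_one_Units
      by (simp add: avb triangular_minus triangular_Units_iff) (simp add: R.minus_eq)
    ultimately show ?thesis by blast
  qed
qed

end

theorem theorem3p4: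
  fixes R :: "('r, 'a) ring_scheme"
    and S :: "('s, 'b) ring_scheme"
    and V :: "('r, 's, 'v, 'c) bimodule_scheme"
  assumes "local_ring R"
    and "local_ring S"
    and "bimodule R S V"
  shows "perfectly_clean_ring (triangular_ring R V S) \<longleftrightarrow>
    (\<forall>a \<in> jacobson_radical R. \<forall>b \<in> \<one>\<^bsub>S\<^esub> <+\<^bsub>S\<^esub> jacobson_radical S. \<forall>v \<in> carrier V.
      \<exists>!x. x \<in> carrier V \<and> a \<odot>\<^bsub>V\<^esub> x \<ominus>\<^bsub>V\<^esub> x \<triangleleft>\<^bsub>V\<^esub> b = v)"
proof -
  interpret LR: local_ring R by fact
  interpret LS: local_ring S by fact
  interpret bimodule R S V by fact
  have J: "a \<in> carrier R" if "a \<in> jacobson_radical R" for a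
    using that LR.J.a_subset by blast
  have coset: "b \<in> \<one>\<^bsub>S\<^esub> <+\<^bsub>S\<^esub> jacobson_radical S \<longleftrightarrow>
      b \<in> carrier S \<and> b \<ominus>\<^bsub>S\<^esub> \<one>\<^bsub>S\<^esub> \<in> jacobson_radical S" for b
    using LS.one_coset_jacobson_iff LS.a_l_coset_subset_G[OF LS.J.a_subset LS.one_closed] by blast
  show ?thesis
    unfolding sylvester_def[symmetric]
  proof (intro iffI ballI)
    fix a b v
    assume "perfectly_clean_ring (triangular_ring R V S)" "a \<in> jacobson_radical R"
      "b \<in> \<one>\<^bsub>S\<^esub> <+\<^bsub>S\<^esub> jacobson_radical S" "v \<in> carrier V"
    then show "\<exists>!x. x \<in> carrier V \<and> sylvester a b x = v"
      using sylvester_unique_solution[OF assms(1,2)] J coset by simp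
  next
    assume "\<forall>a\<in>jacobson_radical R. \<forall>b\<in>\<one>\<^bsub>S\<^esub> <+\<^bsub>S\<^esub> jacobson_radical S. \<forall>v\<in>carrier V.
        \<exists>!x. x \<in> carrier V \<and> sylvester a b x = v"
    then show "perfectly_clean_ring (triangular_ring R V S)"
      using coset by (intro perfectly_clean_triangular[OF assms(1,2)]) simp
  qed
qed

end
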